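(* Let $\lambda>0$ and let $\hat\beta$ be the square-root Lasso, i.e. a minimizer over $\beta\in\mathbb{R}^p$ of $\|Y-X\beta\|_n+\lambda\|\beta\|_1$, where $Y=X\beta^0+\epsilon$, and let $\hat\epsilon:=Y-X\hat\beta$. Let $\hat\lambda_0\ge0$ satisfy $$\hat\lambda_0\|\hat\epsilon\|_n\ge\|\epsilon^TX\|_\infty/n .$$ Define, for $\lambda>\hat\lambda_0$, $$\hat L:=\frac{\lambda+\hat\lambda_0}{\lambda-\hat\lambda_0}.$$ Then $$\|X(\hat\beta-\beta^0)\|_n^2\le\min_{S\subset\{1,\dots,p\}}\ \min_{\beta\in\mathbb{R}^p,\ S_\beta=S}\Big\{\|X(\beta-\beta^0)\|_n^2+(\lambda+\hat\lambda_0)^2\|\hat\epsilon\|_n^2\frac{|S|}{\hat\phi^2(\hat L,S)}\Big\}.$$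
   Context: $X$ is a fixed $n\times p$ real matrix of rank $n$, $Y\in\mathbb{R}^n$, $f^0=\mathbb{E}Y$, $\beta^0\in\mathbb{R}^p$ is a solution of $X\beta^0=f^0$, and $\epsilon:=Y-f^0$, so $Y=X\beta^0+\epsilon$ (the result is deterministic: it holds for any realization of $\epsilon$). For $v\in\mathbb{R}^n$, $\|v\|_n:=\sqrt{v^Tv/n}$. For $\beta\in\mathbb{R}^p$, $S_\beta:=\{j:\beta_j\ne0\}$. For $S\subset\{1,\dots,p\}$, $\beta_S\in\mathbb{R}^p$ has entries $\beta_j$ for $j\in S$ and $0$ otherwise. The compatibility constant, for $L>0$, is $$\hat\phi^2(L,S):=\min\{|S|\,\|X\beta_S-X\beta_{S^c}\|_n^2:\ \|\beta_S\|_1=1,\ \|\beta_{S^c}\|_1\le L\}.$$ Conventions: minima over $\beta$ with $S_\beta=S$ are understood as infima (i.e. the inequality holds for every $\beta$, with $S=S_\beta$); the term containing $|S|/\hat\phi^2(\hat L,S)$ is $0$ if $S=\emptyset$ and $+\infty$ if $S\ne\emptyset$ and $\hat\phi(\hat L,S)=0$. *)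

theory Defs
  imports "HOL-Analysis.Analysis"
begin

definition emp_norm :: "real ^ 'n \<Rightarrow> real" where
  "emp_norm v = sqrt ((v \<bullet> v) / real CARD('n))"

definition l1_norm :: "real ^ 'p \<Rightarrow> real" where
  "l1_norm b = (\<Sum>j\<in>UNIV. \<bar>b $ j\<bar>)"

definition vec_support :: "real ^ 'p \<Rightarrow> 'p set" where
  "vec_support b = {j. b $ j \<noteq> 0}"

definition vec_restrict :: "real ^ 'p \<Rightarrow> 'p set \<Rightarrow> real ^ 'p" where
  "vec_restrict b S = (\<chi> j. if j \<in> S then b $ j else 0)"

definition compat_set :: "real \<Rightarrow> 'p set \<Rightarrow> (real ^ 'p) set" where
  "compat_set L S =
     {b. l1_norm (vec_restrict b S) = 1 \<and> l1_norm (vec_restrict b (- S)) \<le> L}"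

definition compat_objective :: "real ^ 'p ^ 'n \<Rightarrow> 'p set \<Rightarrow> real ^ 'p \<Rightarrow> real" where
  "compat_objective X S b =
     real (card S) * (emp_norm (X *v vec_restrict b S - X *v vec_restrict b (- S)))\<^sup>2"

text \<open>The squared compatibility constant. For nonempty \<open>S\<close> and \<open>L \<ge> 0\<close> the infimum
  is a minimum, see \<open>compat_sq_attained\<close> below. For \<open>S = {}\<close> the index set is empty and the
  value is arbitrary; it is never used.\<close>

definition compat_sq :: "real ^ 'p ^ 'n \<Rightarrow> real \<Rightarrow> 'p set \<Rightarrow> real" where
  "compat_sq X L S = (INF b \<in> compat_set L S. compat_objective X S b)"

text \<open>The value of \<open>c * |S| / compat_sq X L S\<close>, where the whole term counts as \<open>0\<close> for empty
  \<open>S\<close> and as \<open>\<infinity>\<close> for nonempty \<open>S\<close> with vanishing compatibility constant (even if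
  \<open>c = 0\<close>).\<close>

definition compat_term :: "real ^ 'p ^ 'n \<Rightarrow> real \<Rightarrow> 'p set \<Rightarrow> real \<Rightarrow> ereal" where
  "compat_term X L S c =
     (if S = {} then 0
      else if compat_sq X L S = 0 then \<infinity>
      else ereal (c * (real (card S) / compat_sq X L S)))"

definition is_sqrt_lasso ::
  "real ^ 'p ^ 'n \<Rightarrow> real ^ 'n \<Rightarrow> real \<Rightarrow> real ^ 'p \<Rightarrow> bool" where
  "is_sqrt_lasso X Y lam b =
     is_arg_min (\<lambda>b. emp_norm (Y - X *v b) + lam * l1_norm b) (\<lambda>b. True) b"

lemma compat_sq_attained:
  fixes X :: "real ^ 'p ^ 'n"
  assumes "S \<noteq> {}" and "L \<ge> 0"
  shows "\<exists>b \<in> compat_set L S. compat_sq X L S = compat_objective X S b"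
proof -
  have cont_r: "continuous_on UNIV (\<lambda>b :: real ^ 'p. vec_restrict b T)" for T
    unfolding vec_restrict_def
  proof (rule continuous_on_vec_lambda)
    show "continuous_on UNIV (\<lambda>b :: real ^ 'p. if j \<in> T then b $ j else 0)" for j
      by (cases "j \<in> T") (auto intro!: continuous_intros)
  qed
  have cont_l: "continuous_on UNIV (\<lambda>b :: real ^ 'p. l1_norm (vec_restrict b T))" for T
    unfolding l1_norm_def by (intro continuous_intros cont_r)
  have "closed {b :: real ^ 'p. l1_norm (vec_restrict b S) = 1}"
    "closed {b :: real ^ 'p. l1_norm (vec_restrict b (- S)) \<le> L}"
    by (intro closed_Collect_eq closed_Collect_le cont_l continuous_on_const)+
  then have closed: "closed (compat_set L S :: (real ^ 'p) set)"
    unfolding compat_set_def by (rule closed_Collect_conj)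
  have "norm b \<le> 1 + L" if "b \<in> compat_set L S" for b :: "real ^ 'p"
  proof -
    have "norm b \<le> l1_norm b"
      unfolding l1_norm_def by (rule norm_le_l1_cart)
    also have "\<dots> = l1_norm (vec_restrict b S) + l1_norm (vec_restrict b (- S))"
      unfolding l1_norm_def vec_restrict_def sum.distrib[symmetric]
      by (rule sum.cong) auto
    also have "\<dots> \<le> 1 + L"
      using that by (simp add: compat_set_def)
    finally show ?thesis .
  qed
  then have comp: "compact (compat_set L S :: (real ^ 'p) set)"
    using closed by (auto simp: compact_eq_bounded_closed bounded_iff)
  obtain s where s: "s \<in> S" using assms(1) by blast
  have "axis s 1 \<in> compat_set L S"
  proof -
    have "\<bar>vec_restrict (axis s 1 :: real ^ 'p) S $ j\<bar> = (if j = s then 1 else 0)"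
      and "vec_restrict (axis s 1 :: real ^ 'p) (- S) $ j = 0" for j
      using s by (auto simp: vec_restrict_def axis_def)
    then show ?thesis
      using assms(2) by (simp add: compat_set_def l1_norm_def)
  qed
  then have ne: "compat_set L S \<noteq> ({} :: (real ^ 'p) set)" by blast
  have "continuous_on (compat_set L S) (compat_objective X S)"
    unfolding compat_objective_def emp_norm_def
    by (intro continuous_intros continuous_on_subset[OF cont_r]
        continuous_on_compose2[OF matrix_vector_mult_linear_continuous_on[of UNIV X]]
        subset_UNIV) auto
  from continuous_attains_inf[OF comp ne this] obtain b where
    b: "b \<in> compat_set L S" "\<And>c. c \<in> compat_set L S \<Longrightarrow> compat_objective X S b \<le> compat_objective X S c"
    by blast
  have "compat_sq X L S = compat_objective X S b"
    unfolding compat_sq_def using b by (intro cInf_eq_minimum) auto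
  with b(1) show ?thesis by blast
qed

end

theory Submission
  imports Defs
begin

text \<open>The first-order optimality condition of the square-root Lasso in the direction
  \<open>\<beta> - \<beta>'\<close>, \<open>\<beta>'\<close> the minimizer and \<open>r = Y - X \<beta>'\<close> its residual, reads
  \<open>\<langle>r, X (\<beta> - \<beta>')\<rangle> / n \<le> \<lambda> \<parallel>r\<parallel> (\<parallel>\<beta>\<parallel>\<^sub>1 - \<parallel>\<beta>'\<parallel>\<^sub>1)\<close> for
  \<open>r \<noteq> 0\<close>. Polarization and the dual norm bound on the noise turn it, with
  \<open>d = \<beta>' - \<beta>\<close> and \<open>S\<close> the support of \<open>\<beta>\<close>, into
  \<open>\<parallel>X d\<parallel>\<^sup>2 + \<parallel>X (\<beta>' - \<beta>\<^sup>0)\<parallel>\<^sup>2 \<le> \<parallel>X (\<beta> - \<beta>\<^sup>0)\<parallel>\<^sup>2 + 2 \<parallel>r\<parallel> ((\<lambda> + \<lambda>\<^sub>0) \<parallel>d\<^sub>S\<parallel>\<^sub>1 - (\<lambda> - \<lambda>\<^sub>0) \<parallel>d\<^bsub>-S\<^esub>\<parallel>\<^sub>1)\<close>.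
  Either the last bracket is nonpositive, or \<open>d\<close> lies in the cone of the compatibility constant and
  \<open>2 a b \<le> a\<^sup>2 + b\<^sup>2\<close> absorbs the bracket into \<open>\<parallel>X d\<parallel>\<^sup>2\<close>. If \<open>r = 0\<close>, the noise is
  orthogonal to the columns of \<open>X\<close>; by the rank condition it vanishes, and so does the left-hand side.\<close>

lemma emp_norm_nonneg: "0 \<le> emp_norm v"
  by (simp add: emp_norm_def)

lemma emp_norm_sq: "(emp_norm (v :: real ^ 'n))\<^sup>2 = (v \<bullet> v) / real CARD('n)"
  by (simp add: emp_norm_def)

lemma emp_norm_eq_0_iff: "emp_norm v = 0 \<longleftrightarrow> v = 0"
  by (simp add: emp_norm_def)

lemma emp_norm_scaleR: "emp_norm (c *\<^sub>R v) = \<bar>c\<bar> * emp_norm v"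
  by (simp add: emp_norm_def real_sqrt_mult real_sqrt_divide)

lemma l1_norm_nonneg: "0 \<le> l1_norm b"
  by (simp add: l1_norm_def sum_nonneg)

lemma l1_norm_scaleR: "l1_norm (c *\<^sub>R b) = \<bar>c\<bar> * l1_norm b"
  by (simp add: l1_norm_def sum_distrib_left abs_mult)

lemma l1_norm_triangle: "l1_norm (a + b) \<le> l1_norm a + l1_norm b"
  unfolding l1_norm_def sum.distrib[symmetric] by (rule sum_mono) simp

lemma l1_norm_split: "l1_norm b = l1_norm (vec_restrict b S) + l1_norm (vec_restrict b (- S))"
  unfolding l1_norm_def vec_restrict_def sum.distrib[symmetric] by (rule sum.cong) auto

lemma vec_restrict_add_compl: "vec_restrict b S + vec_restrict b (- S) = b"
  by (auto simp: vec_restrict_def vec_eq_iff)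

lemma l1_norm_diff_le_support:
  "l1_norm b - l1_norm c
    \<le> l1_norm (vec_restrict (c - b) (vec_support b)) - l1_norm (vec_restrict (c - b) (- vec_support b))"
  unfolding l1_norm_def vec_restrict_def sum_subtractf[symmetric]
  by (rule sum_mono) (auto simp: vec_support_def)

lemma inner_le_infnorm_l1: "(a :: real ^ 'p) \<bullet> b \<le> infnorm a * l1_norm b"
proof -
  have "a \<bullet> b = (\<Sum>j\<in>UNIV. a $ j * b $ j)"
    by (simp add: inner_vec_def)
  also have "\<dots> \<le> (\<Sum>j\<in>UNIV. infnorm a * \<bar>b $ j\<bar>)"
  proof (rule sum_mono)
    fix j
    have "a $ j * b $ j \<le> \<bar>a $ j\<bar> * \<bar>b $ j\<bar>"
      by (metis abs_ge_self abs_mult)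
    also have "\<dots> \<le> infnorm a * \<bar>b $ j\<bar>"
      by (intro mult_right_mono component_le_infnorm_cart) simp
    finally show "a $ j * b $ j \<le> infnorm a * \<bar>b $ j\<bar>" .
  qed
  finally show ?thesis
    by (simp add: l1_norm_def sum_distrib_left)
qed

lemma compat_objective_nonneg: "0 \<le> compat_objective X S b"
  by (simp add: compat_objective_def)

lemma compat_sq_nonneg:
  assumes "S \<noteq> {}" and "L \<ge> 0"
  shows "0 \<le> compat_sq X L S"
  using compat_sq_attained[OF assms, of X] compat_objective_nonneg by metis

lemma compat_term_nonneg:
  assumes "L \<ge> 0" and "c \<ge> 0"
  shows "0 \<le> compat_term X L S c"
  using assms compat_sq_nonneg[OF _ assms(1), of S X] by (simp add: compat_term_def)

lemma compat_sq_le: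
  assumes "b \<in> compat_set L S"
  shows "compat_sq X L S \<le> compat_objective X S b"
  unfolding compat_sq_def using assms
  by (intro cINF_lower bdd_belowI[of _ 0]) (auto simp: compat_objective_nonneg)

lemma compat_sq_cone:
  fixes X :: "real ^ 'p ^ 'n"
  assumes pos: "l1_norm (vec_restrict d S) > 0"
    and cone: "l1_norm (vec_restrict d (- S)) \<le> L * l1_norm (vec_restrict d S)"
  shows "(l1_norm (vec_restrict d S))\<^sup>2 * compat_sq X L S \<le> real (card S) * (emp_norm (X *v d))\<^sup>2"
proof -
  define s where "s = l1_norm (vec_restrict d S)"
  \<comment> \<open>The compatibility constant is phrased with \<open>X b\<^sub>S - X b\<^bsub>-S\<^esub>\<close>, hence the sign flip outside \<open>S\<close>.\<close>
  define b where "b = (1 / s) *\<^sub>R (vec_restrict d S - vec_restrict d (- S))"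
  have s: "s > 0" using pos by (simp add: s_def)
  have bS: "vec_restrict b S = (1 / s) *\<^sub>R vec_restrict d S"
    and bC: "vec_restrict b (- S) = (- 1 / s) *\<^sub>R vec_restrict d (- S)"
    by (auto simp: b_def vec_restrict_def vec_eq_iff)
  have "b \<in> compat_set L S"
    unfolding compat_set_def mem_Collect_eq bS bC l1_norm_scaleR
    using s cone by (simp add: pos_divide_le_eq flip: s_def)
  then have le: "compat_sq X L S \<le> compat_objective X S b"
    by (rule compat_sq_le)
  have "vec_restrict b S - vec_restrict b (- S) = (1 / s) *\<^sub>R d"
    by (simp add: bS bC flip: scaleR_add_right) (simp add: vec_restrict_add_compl)
  then have "X *v vec_restrict b S - X *v vec_restrict b (- S) = (1 / s) *\<^sub>R (X *v d)"
    by (metis matrix_vector_mult_diff_distrib matrix_vector_mult_scaleR)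
  then have "compat_objective X S b = real (card S) * (emp_norm (X *v d))\<^sup>2 / s\<^sup>2"
    by (simp add: compat_objective_def emp_norm_scaleR power_divide)
  with le s show ?thesis
    by (simp add: field_simps flip: s_def)
qed

lemma sqrt_lasso_optimality:
  fixes X :: "real ^ 'p ^ 'n"
  assumes min: "is_sqrt_lasso X Y lam b'" and lam: "lam > 0"
    and r: "r = Y - X *v b'" and r0: "r \<noteq> 0"
  shows "(r \<bullet> (X *v (b - b'))) / real CARD('n) \<le> lam * emp_norm r * (l1_norm b - l1_norm b')"
proof -
  define v where "v = X *v (b - b')"
  define e where "e = emp_norm r"
  define D where "D = l1_norm b - l1_norm b'"
  define n where "n = real CARD('n)"
  have n: "n > 0" by (simp add: n_def)
  have e: "e > 0"
    using r0 emp_norm_nonneg[of r] emp_norm_eq_0_iff[of r] by (simp add: e_def)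
  have small: "(r \<bullet> v) / n - lam * e * D \<le> t * ((v \<bullet> v) / (2 * n))" if t: "0 < t" "t \<le> 1" for t
  proof -
    define bt where "bt = (1 - t) *\<^sub>R b' + t *\<^sub>R b"
    define a where "a = emp_norm (r - t *\<^sub>R v)"
    have "Y - X *v bt = r - t *\<^sub>R v"
      by (simp add: bt_def r v_def algebra_simps matrix_vector_mult_scaleR
          matrix_vector_mult_diff_distrib matrix_vector_right_distrib)
    moreover have "emp_norm (Y - X *v b') + lam * l1_norm b' \<le> emp_norm (Y - X *v bt) + lam * l1_norm bt"
      using min by (auto simp: is_sqrt_lasso_def is_arg_min_def not_less)
    ultimately have "e + lam * l1_norm b' \<le> a + lam * l1_norm bt"
      by (simp only: a_def e_def flip: r)
    moreover have "l1_norm bt \<le> l1_norm b' + t * D"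
      using l1_norm_triangle[of "(1 - t) *\<^sub>R b'" "t *\<^sub>R b"] t
      unfolding bt_def D_def l1_norm_scaleR by (simp add: left_diff_distrib right_diff_distrib)
    then have "lam * l1_norm bt \<le> lam * (l1_norm b' + t * D)"
      using lam by simp
    ultimately have "e - a \<le> lam * (t * D)"
      by (simp add: algebra_simps)
    then have "2 * e * (e - a) \<le> 2 * e * (lam * (t * D))"
      using e by simp
    moreover have "e\<^sup>2 - a\<^sup>2 \<le> 2 * e * (e - a)"
      using zero_le_power2[of "e - a"] by (simp add: power2_eq_square algebra_simps)
    moreover have "e\<^sup>2 - a\<^sup>2 = t * (2 * ((r \<bullet> v) / n) - t * ((v \<bullet> v) / n))"
      by (simp add: e_def a_def emp_norm_sq n_def inner_diff inner_commute diff_divide_distrib add_divide_distrib algebra_simps)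
    ultimately have "t * (2 * ((r \<bullet> v) / n) - t * ((v \<bullet> v) / n)) \<le> t * (2 * (lam * e * D))"
      by (simp add: algebra_simps)
    then have "2 * ((r \<bullet> v) / n) - t * ((v \<bullet> v) / n) \<le> 2 * (lam * e * D)"
      using t by simp
    then show ?thesis
      by simp
  qed
  have lim: "((\<lambda>t. t * ((v \<bullet> v) / (2 * n))) \<longlongrightarrow> 0 * ((v \<bullet> v) / (2 * n))) (at_right 0)"
    by (intro tendsto_intros)
  have "(r \<bullet> v) / n - lam * e * D \<le> 0 * ((v \<bullet> v) / (2 * n))"
  proof (rule tendsto_lowerbound[OF lim])
    show "\<forall>\<^sub>F t in at_right 0. (r \<bullet> v) / n - lam * e * D \<le> t * ((v \<bullet> v) / (2 * n))"
      unfolding eventually_at_right_field using small by (intro exI[of _ 1]) auto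
  qed simp
  then show ?thesis
    by (simp add: v_def e_def D_def n_def)
qed

lemma full_row_rank_eq_0:
  fixes X :: "real ^ 'p ^ 'n"
  assumes "rank X = CARD('n)" and "v v* X = 0"
  shows "v = 0"
proof -
  have "inj ((*v) (transpose X))"
    using assms(1) full_rank_injective[of "transpose X"] by (simp add: rank_transpose)
  moreover have "transpose X *v v = transpose X *v 0"
    using assms(2) by simp
  ultimately show ?thesis
    by (rule injD)
qed

lemma sqrt_lasso_basic_inequality:
  fixes X :: "real ^ 'p ^ 'n" and b :: "real ^ 'p"
  assumes min: "is_sqrt_lasso X (X *v b0 + eps) lam b'" and lam: "lam > 0"
    and r: "r = X *v b0 + eps - X *v b'" and r0: "r \<noteq> 0"
    and noise: "infnorm (eps v* X) / real CARD('n) \<le> lam0 * emp_norm r"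
  defines "S \<equiv> vec_support b"
  shows "(emp_norm (X *v (b' - b)))\<^sup>2 + (emp_norm (X *v (b' - b0)))\<^sup>2
    \<le> (emp_norm (X *v (b - b0)))\<^sup>2
      + 2 * emp_norm r * ((lam + lam0) * l1_norm (vec_restrict (b' - b) S)
                          - (lam - lam0) * l1_norm (vec_restrict (b' - b) (- S)))"
proof -
  define n where "n = real CARD('n)"
  define d where "d = b' - b"
  define e where "e = emp_norm r"
  define s c where "s = l1_norm (vec_restrict d S)" and "c = l1_norm (vec_restrict d (- S))"
  define u where "u = X *v (b' - b0)"
  have n: "n > 0" by (simp add: n_def)
  have re: "r = eps - u" and Xb: "X *v (b - b0) = u - X *v d" and Xd: "X *v (b - b') = - (X *v d)"
    by (simp_all add: r u_def d_def matrix_vector_mult_diff_distrib)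
  have "(r \<bullet> (X *v (b - b'))) / n \<le> lam * e * (l1_norm b - l1_norm b')"
    using sqrt_lasso_optimality[OF min lam r r0] by (simp add: e_def n_def)
  also have "\<dots> \<le> lam * e * (s - c)"
    using lam emp_norm_nonneg[of r] l1_norm_diff_le_support[of b b']
    by (intro mult_left_mono) (auto simp: s_def c_def d_def S_def e_def)
  finally have 1: "(u \<bullet> (X *v d)) / n - (eps \<bullet> (X *v d)) / n \<le> lam * e * (s - c)"
    by (simp add: re Xd inner_diff_left diff_divide_distrib)
  have "(eps \<bullet> (X *v d)) / n = ((eps v* X) \<bullet> d) / n"
    by (simp add: dot_lmul_matrix)
  also have "\<dots> \<le> infnorm (eps v* X) / n * l1_norm d"
    using inner_le_infnorm_l1[of "eps v* X" d] n by (simp add: divide_right_mono)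
  also have "\<dots> \<le> lam0 * e * (s + c)"
    using mult_right_mono[OF noise l1_norm_nonneg[of d]] l1_norm_split[of d S]
    by (simp add: e_def n_def s_def c_def)
  finally have "(u \<bullet> (X *v d)) / n \<le> lam * e * (s - c) + lam0 * e * (s + c)"
    using 1 by simp
  moreover have "(emp_norm (X *v d))\<^sup>2 + (emp_norm u)\<^sup>2
      = (emp_norm (u - X *v d))\<^sup>2 + 2 * ((u \<bullet> (X *v d)) / n)"
    by (simp add: emp_norm_sq n_def inner_diff inner_commute diff_divide_distrib add_divide_distrib algebra_simps)
  ultimately show ?thesis
    unfolding Xb u_def[symmetric] d_def[symmetric] s_def[symmetric] c_def[symmetric] e_def[symmetric]
    by (simp add: algebra_simps)
qed

lemma compat_term_absorbs:
  fixes X :: "real ^ 'p ^ 'n"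
  assumes e: "e \<ge> 0" and lam: "0 \<le> lam0" "lam0 < lam"
    and L: "L = (lam + lam0) / (lam - lam0)"
  shows "ereal (2 * e * ((lam + lam0) * l1_norm (vec_restrict d S)
                        - (lam - lam0) * l1_norm (vec_restrict d (- S))))
    \<le> ereal ((emp_norm (X *v d))\<^sup>2) + compat_term X L S ((lam + lam0)\<^sup>2 * e\<^sup>2)"
proof -
  define s c where "s = l1_norm (vec_restrict d S)" and "c = l1_norm (vec_restrict d (- S))"
  define phi where "phi = compat_sq X L S"
  define k where "k = real (card S)"
  define K where "K = (lam + lam0) * e"
  have L0: "L \<ge> 0" and s0: "s \<ge> 0" and c0: "c \<ge> 0"
    using lam by (simp_all add: L s_def c_def l1_norm_nonneg)
  have sq: "(lam + lam0)\<^sup>2 * e\<^sup>2 = K\<^sup>2" by (simp add: K_def power_mult_distrib)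
  have term0: "0 \<le> compat_term X L S (K\<^sup>2)"
    using L0 by (intro compat_term_nonneg) auto
  show ?thesis
  proof (cases "(lam + lam0) * s \<le> (lam - lam0) * c")
    case True
    then have "2 * e * ((lam + lam0) * s - (lam - lam0) * c) \<le> 0"
      using e by (intro mult_nonneg_nonpos) auto
    then have "ereal (2 * e * ((lam + lam0) * s - (lam - lam0) * c)) \<le> ereal ((emp_norm (X *v d))\<^sup>2) + 0"
      by (simp add: order_trans[OF _ zero_le_power2])
    also have "\<dots> \<le> ereal ((emp_norm (X *v d))\<^sup>2) + compat_term X L S (K\<^sup>2)"
      by (intro add_left_mono term0)
    finally show ?thesis by (simp add: sq s_def c_def)
  next
    case False
    have "s \<noteq> 0"
    proof
      assume "s = 0"
      with False mult_nonneg_nonneg[of "lam - lam0" c] lam c0 show False by simp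
    qed
    with s0 have s: "s > 0" by simp
    then have S: "S \<noteq> {}"
      by (auto simp: s_def l1_norm_def vec_restrict_def)
    have "c \<le> L * s"
      using False lam by (simp add: L field_simps)
    then have cone: "s\<^sup>2 * phi \<le> k * (emp_norm (X *v d))\<^sup>2"
      using compat_sq_cone[of d S L X] s by (simp add: s_def c_def phi_def k_def)
    show ?thesis
    proof (cases "phi = 0")
      case True
      then show ?thesis using S by (simp add: compat_term_def phi_def)
    next
      case False
      then have phi: "phi > 0"
        using compat_sq_nonneg[OF S L0, of X] by (simp add: phi_def)
      have k: "k > 0" using S by (simp add: k_def card_gt_0_iff)
      have "2 * e * ((lam + lam0) * s - (lam - lam0) * c) \<le> 2 * K * s"
        using e lam c0 by (simp add: K_def algebra_simps mult_left_mono)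
      also have "2 * K * s \<le> s\<^sup>2 * phi / k + K\<^sup>2 * (k / phi)"
      proof -
        have "0 \<le> (s * phi - K * k)\<^sup>2 / (k * phi)"
          using k phi by simp
        also have "\<dots> = s\<^sup>2 * phi / k + K\<^sup>2 * (k / phi) - 2 * K * s"
          using k phi by (simp add: field_simps power2_eq_square)
        finally show ?thesis by simp
      qed
      also have "s\<^sup>2 * phi / k \<le> (emp_norm (X *v d))\<^sup>2"
        using cone k by (simp add: field_simps)
      finally show ?thesis
        using S False by (simp add: compat_term_def sq s_def c_def phi_def k_def)
    qed
  qed
qed

theorem proposition1p4p1:
  fixes X :: "real ^ 'p ^ 'n"
    and Y f0 eps epshat :: "real ^ 'n"
    and beta0 betahat :: "real ^ 'p"
    and lam lam0 Lhat :: real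
  assumes "rank X = CARD('n)"
    and "X *v beta0 = f0"
    and "eps = Y - f0"
    and "lam > 0"
    and "is_sqrt_lasso X Y lam betahat"
    and "epshat = Y - X *v betahat"
    and "lam0 \<ge> 0"
    and "lam0 * emp_norm epshat \<ge> infnorm (eps v* X) / real CARD('n)"
    and "lam > lam0"
    and "Lhat = (lam + lam0) / (lam - lam0)"
  shows "ereal ((emp_norm (X *v (betahat - beta0)))\<^sup>2)
    \<le> (INF S \<in> (UNIV :: 'p set set). INF beta \<in> {beta. vec_support beta = S}.
         ereal ((emp_norm (X *v (beta - beta0)))\<^sup>2)
         + compat_term X Lhat S ((lam + lam0)\<^sup>2 * (emp_norm epshat)\<^sup>2))"
proof (intro INF_greatest)
  fix S :: "'p set" and beta :: "real ^ 'p"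
  assume "beta \<in> {beta. vec_support beta = S}"
  then have S: "S = vec_support beta" by simp
  have Y: "Y = X *v beta0 + eps" using assms(2,3) by simp
  define K where "K = (lam + lam0)\<^sup>2 * (emp_norm epshat)\<^sup>2"
  show "ereal ((emp_norm (X *v (betahat - beta0)))\<^sup>2)
    \<le> ereal ((emp_norm (X *v (beta - beta0)))\<^sup>2)
       + compat_term X Lhat S ((lam + lam0)\<^sup>2 * (emp_norm epshat)\<^sup>2)"
  proof (cases "epshat = 0")
    case True
    then have "infnorm (eps v* X) \<le> 0"
      using assms(8) by (simp add: emp_norm_def divide_le_0_iff)
    then have "eps v* X = 0"
      using infnorm_pos_le[of "eps v* X"] infnorm_eq_0[of "eps v* X"] by linarith
    then have "eps = 0"
      by (rule full_row_rank_eq_0[OF assms(1)])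
    then have "X *v (betahat - beta0) = 0"
      using True Y assms(6) by (simp add: matrix_vector_mult_diff_distrib)
    moreover have "0 \<le> compat_term X Lhat S K"
      using assms(7,9,10) by (intro compat_term_nonneg) (auto simp: K_def)
    ultimately show ?thesis
      unfolding K_def[symmetric] by (cases "compat_term X Lhat S K") (auto simp: emp_norm_eq_0_iff[THEN iffD2])
  next
    case False
    define R where "R = 2 * emp_norm epshat
      * ((lam + lam0) * l1_norm (vec_restrict (betahat - beta) S)
         - (lam - lam0) * l1_norm (vec_restrict (betahat - beta) (- S)))"
    have "(emp_norm (X *v (betahat - beta)))\<^sup>2 + (emp_norm (X *v (betahat - beta0)))\<^sup>2
      \<le> (emp_norm (X *v (beta - beta0)))\<^sup>2 + R"
      using sqrt_lasso_basic_inequality[OF assms(5)[unfolded Y] assms(4) assms(6)[unfolded Y] False assms(8)]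
      by (simp add: S R_def)
    moreover have "ereal R \<le> ereal ((emp_norm (X *v (betahat - beta)))\<^sup>2) + compat_term X Lhat S K"
      unfolding R_def K_def using assms(7,9,10) by (intro compat_term_absorbs emp_norm_nonneg)
    ultimately show ?thesis
      unfolding K_def[symmetric] by (cases "compat_term X Lhat S K") auto
  qed
qed

end
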